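(* Let $s\ge 2$ be a rational number, let $q$ be its denominator (when $s$ is written in lowest terms), and let $t=\lfloor \log_2 s\rfloor$. Let $m\ge 1$ be an integer. Then for any set system $\mathcal S$, \[ f_{\mathcal S}(m)\le sm-3qs^2\log_2 s \quad\Longrightarrow\quad \text{for all } n\ge m,\quad f_{\mathcal S}(n)\le 2^{t+2}m^{2t+2}\,n^{\,t+1-(2^{t+1}-t-2)/(s-1)}.\]
   Context: A set system $\mathcal S$ is a family of subsets of a ground set $X$. For $Y\subseteq X$, the trace of $\mathcal S$ on $Y$ is $\mathcal S_{|Y}=\{e\cap Y: e\in\mathcal S\}$. The shatter function of $\mathcal S$ is $f_{\mathcal S}(m)=\max\{|\mathcal S_{|Y}| : Y\subseteq X,\ |Y|=m\}$, defined for integers $m\le|X|$; the conclusion concerns all integers $n\ge m$ for which $f_{\mathcal S}(n)$ is defined. *)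

theory Defs
  imports Complex_Main
begin

text \<open>A set system is a ground set \<open>X\<close>, finite or infinite, with a family \<open>S \<subseteq> Pow X\<close>.\<close>

definition set_system :: "'a set \<Rightarrow> 'a set set \<Rightarrow> bool" where
  "set_system X S \<longleftrightarrow> S \<subseteq> Pow X"

definition trace :: "'a set set \<Rightarrow> 'a set \<Rightarrow> 'a set set" where
  "trace S Y = {e \<inter> Y | e. e \<in> S}"

text \<open>The ground set has at least \<open>m\<close> elements; the infinite case is separate because
  \<open>card\<close> is \<open>0\<close> on infinite sets.\<close>

definition shatter_defined :: "'a set \<Rightarrow> nat \<Rightarrow> bool" where
  "shatter_defined X m \<longleftrightarrow> infinite X \<or> m \<le> card X"

text \<open>The value is meaningful only if \<open>shatter_defined X m\<close>. In that case the set below is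
  nonempty, and it is finite because a trace on \<open>m\<close> points has at most \<open>2 ^ m\<close> members, even
  if \<open>X\<close> and \<open>S\<close> are infinite.\<close>

definition shatter :: "'a set \<Rightarrow> 'a set set \<Rightarrow> nat \<Rightarrow> nat" where
  "shatter X S m = Max {card (trace S Y) | Y. Y \<subseteq> X \<and> finite Y \<and> card Y = m}"

lemma shatter_set_finite:
  "finite {card (trace S Y) | Y. Y \<subseteq> X \<and> finite Y \<and> card Y = m}"
proof (rule finite_subset)
  show "{card (trace S Y) | Y. Y \<subseteq> X \<and> finite Y \<and> card Y = m} \<subseteq> {..2 ^ m}"
  proof clarsimp
    fix Y :: "'a set"
    assume "finite Y"
    moreover have "trace S Y \<subseteq> Pow Y"
      by (auto simp: trace_def)
    ultimately show "card (trace S Y) \<le> 2 ^ card Y"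
      by (metis card_Pow card_mono finite_Pow_iff)
  qed
qed simp

lemma shatter_set_nonempty:
  assumes "shatter_defined X m"
  shows "{card (trace S Y) | Y. Y \<subseteq> X \<and> finite Y \<and> card Y = m} \<noteq> {}"
proof -
  have "\<exists>Y. Y \<subseteq> X \<and> finite Y \<and> card Y = m"
    using assms unfolding shatter_defined_def
    by (metis infinite_arbitrarily_large obtain_subset_with_card_n)
  then show ?thesis
    by blast
qed

end

theory Submission
  imports Defs "HOL-Library.FuncSet"
begin

text \<open>Down-shifting does not increase traces, so the system may be taken to be a simplicial complex on
  \<open>n\<close> points in which \<open>m\<close> points span at most \<open>s m - 3 q s\<^sup>2 t\<close> faces.

  For \<open>k \<le> t\<close> the number of faces of size \<open>k + 1\<close> is at most \<open>2 m n\<^bsup>\<delta>\<^esup>\<close> times the number of faces of size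
  \<open>k\<close>, where \<open>\<delta> = (s - 2\<^bsup>k\<^esup>) / (s - 1)\<close>. Otherwise some family of faces of size \<open>k + 1\<close> has all its
  \<open>k\<close>-subsets in at least \<open>2 m n\<^bsup>\<delta>\<^esup>\<close> members, and a fixed tree of such faces embeds greedily in very many
  ways. A fraction \<open>\<delta>\<close> of its vertices are leaves; by pigeonhole many embeddings agree on the leaves.
  The tree is balanced: any set of non-leaves meets at least \<open>s\<close> faces per vertex. So every
  further embedding adds at least \<open>s\<close> faces per new vertex to the union of the previous ones, and the union
  becomes too dense when it reaches about \<open>m\<close> vertices.

  A face of size \<open>t + 1\<close> lies in at most \<open>m\<close> faces, because each vertex of its link contributes
  \<open>2\<^bsup>t + 1\<^esup> > s\<close> faces. Multiplying the bounds for \<open>k = 1, \<dots>, t\<close> gives the exponent.\<close>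

subsection \<open>Down-shifting\<close>

definition shift :: "'a \<Rightarrow> 'a set set \<Rightarrow> 'a set \<Rightarrow> 'a set" where
  "shift x F A = (if A - {x} \<in> F then A else A - {x})"

text \<open>A member that moves lands outside \<open>F\<close>, so it never meets one that stays.
  Two moved members both contain \<open>x\<close>, so each is recovered by putting \<open>x\<close>
  back.\<close>

lemma inj_on_shift: "inj_on (shift x F) F"
  unfolding inj_on_def shift_def by (metis Diff_empty Diff_insert0 insert_Diff)

text \<open>Deleting \<open>x\<close> commutes with tracing. A member kept by the shift is also kept
  in the trace. One that moves leaves a set without \<open>x\<close>, which is either already in the
  trace and fixed there, or the shifted image of \<open>A \<inter> Y\<close>.\<close>

lemma trace_shift_subset:
  assumes "x \<in> Y"
  shows "trace (shift x F ` F) Y \<subseteq> shift x (trace F Y) ` trace F Y"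
proof
  fix B assume "B \<in> trace (shift x F ` F) Y"
  then obtain A where A: "A \<in> F" and B: "B = shift x F A \<inter> Y"
    by (auto simp: trace_def)
  have tr: "A' \<inter> Y \<in> trace F Y" if "A' \<in> F" for A'
    using that by (auto simp: trace_def)
  have eq: "(A - {x}) \<inter> Y = A \<inter> Y - {x}" by auto
  show "B \<in> shift x (trace F Y) ` trace F Y"
  proof (cases "A - {x} \<in> F")
    case True
    then have "A \<inter> Y - {x} \<in> trace F Y" using tr[OF True] eq by simp
    then have "shift x (trace F Y) (A \<inter> Y) = B" using True B by (simp add: shift_def)
    then show ?thesis using tr[OF A] by blast
  next
    case False
    then have B': "B = A \<inter> Y - {x}" using B eq by (simp add: shift_def)
    show ?thesis
    proof (cases "B \<in> trace F Y")
      case True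
      then have "shift x (trace F Y) B = B" by (simp add: B' shift_def)
      then show ?thesis using True by force
    next
      case False
      then have "shift x (trace F Y) (A \<inter> Y) = B" by (simp add: B' shift_def)
      then show ?thesis using tr[OF A] by blast
    qed
  qed
qed

lemma card_trace_shift_le:
  assumes "finite F"
  shows "card (trace (shift x F ` F) Y) \<le> card (trace F Y)"
proof (cases "x \<in> Y")
  case True
  have fin: "finite (trace F Y)" using assms by (simp add: trace_def)
  have "card (trace (shift x F ` F) Y) \<le> card (shift x (trace F Y) ` trace F Y)"
    using trace_shift_subset[OF True] fin by (intro card_mono) auto
  also have "\<dots> \<le> card (trace F Y)" by (rule card_image_le[OF fin])
  finally show ?thesis .
next
  case False
  then have "shift x F A \<inter> Y = A \<inter> Y" for A by (auto simp: shift_def)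
  then have "trace (shift x F ` F) Y = trace F Y" by (auto simp: trace_def)
  then show ?thesis by simp
qed

text \<open>Among all families on \<open>V\<close> with the same cardinality and no larger traces,
  one of least total size is closed under deleting a point: otherwise a shift would keep both
  properties and lower the total.\<close>

lemma exists_hereditary:
  assumes V: "finite V" and F: "F \<subseteq> Pow V"
  obtains D where "D \<subseteq> Pow V" "card D = card F"
    "\<And>A B. A \<in> D \<Longrightarrow> B \<subseteq> A \<Longrightarrow> B \<in> D"
    "\<And>Y. card (trace D Y) \<le> card (trace F Y)"
proof -
  define P where "P D \<longleftrightarrow> D \<subseteq> Pow V \<and> card D = card F \<and> (\<forall>Y. card (trace D Y) \<le> card (trace F Y))"
    for D
  define D where "D = arg_min (\<lambda>D. \<Sum>A\<in>D. card A) P"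
  have "P F" using F by (simp add: P_def)
  then have PD: "P D" and min: "\<And>D'. P D' \<Longrightarrow> (\<Sum>A\<in>D. card A) \<le> (\<Sum>A\<in>D'. card A)"
    unfolding D_def by (auto intro: arg_min_natI arg_min_nat_le)
  have DV: "D \<subseteq> Pow V" and finD: "finite D"
    using PD V finite_subset by (auto simp: P_def)
  have closed1: "A - {x} \<in> D" if A: "A \<in> D" for A x
  proof (rule ccontr)
    assume notin: "A - {x} \<notin> D"
    have fin: "finite A'" if "A' \<in> D" for A'
      using that DV V finite_subset by blast
    have "(\<Sum>A\<in>shift x D ` D. card A) = (\<Sum>A\<in>D. card (shift x D A))"
      by (simp add: sum.reindex[OF inj_on_shift])
    also have "\<dots> < (\<Sum>A\<in>D. card A)"
    proof (rule sum_strict_mono_ex1[OF finD])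
      show "\<forall>A\<in>D. card (shift x D A) \<le> card A"
        by (auto simp: shift_def fin card_Diff1_le)
      have "x \<in> A" using notin A by (metis Diff_empty Diff_insert0)
      then have "card (shift x D A) < card A"
        using notin fin[OF A] by (simp add: shift_def card_Diff1_less del: card_Diff_insert)
      then show "\<exists>A\<in>D. card (shift x D A) < card A" using A by blast
    qed
    finally have less: "(\<Sum>A\<in>shift x D ` D. card A) < (\<Sum>A\<in>D. card A)" .
    have "shift x D ` D \<subseteq> Pow V" using DV by (auto simp: shift_def)
    moreover have "card (shift x D ` D) = card F"
      using PD card_image[OF inj_on_shift] by (metis P_def)
    moreover have "card (trace (shift x D ` D) Y) \<le> card (trace F Y)" for Y
      using card_trace_shift_le[OF finD] PD le_trans unfolding P_def by blast
    ultimately have "P (shift x D ` D)" by (simp add: P_def)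
    then show False using min less by fastforce
  qed
  have "A - C \<in> D" if A: "A \<in> D" and C: "finite C" for A C
    using C
  proof (induction C rule: finite_induct)
    case empty then show ?case using A by simp
  next
    case (insert x C)
    then show ?case using closed1[of "A - C" x] by (metis Diff_insert)
  qed
  note closed = this
  have "B \<in> D" if A: "A \<in> D" and B: "B \<subseteq> A" for A B
  proof -
    have "finite (A - B)" using A DV V finite_subset by blast
    moreover have "A - (A - B) = B" using B by blast
    ultimately show ?thesis using closed[OF A] by metis
  qed
  with PD show thesis by (intro that[of D]) (auto simp: P_def)
qed

subsection \<open>The balanced tree\<close>

text \<open>As a function of \<open>c\<close>, \<open>2^k - 2^(k - c)\<close> is concave and
  vanishes at \<open>0\<close>, so it lies above its chord over \<open>[0, k]\<close>. With
  \<open>k = c + d\<close> the claim reduces to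
  \<open>c (2^d - 1) \<le> (2^c - 1) d 2^d\<close>.\<close>

lemma power_diff_concave:
  fixes c k :: nat
  assumes "c \<le> k"
  shows "real c * (2 ^ k - 1) \<le> real k * (2 ^ k - 2 ^ (k - c))"
proof -
  obtain d where k: "k = c + d" using assms le_Suc_ex by blast
  have "real c \<le> 2 ^ c - 1"
    using less_exp[of c] by (metis Suc_leI le_diff_eq of_nat_Suc of_nat_le_numeral_power_cancel_iff add.commute of_nat_1 of_nat_add plus_1_eq_Suc)
  moreover have "(2 :: real) ^ d - 1 \<le> real d * 2 ^ d" by (cases d) (auto simp: field_simps)
  ultimately have "real c * (2 ^ d - 1) \<le> (2 ^ c - 1) * (real d * 2 ^ d)"
    by (intro mult_mono) auto
  then show ?thesis by (simp add: k power_add algebra_simps)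
qed

text \<open>\<open>owner B R\<close> spreads \<open>R\<close> leaves as evenly as possible over the blocks \<open>1, \<dots>, B\<close>: the first \<open>b\<close>
  blocks own \<open>\<lfloor>b R / B\<rfloor>\<close> of them.\<close>

definition owner :: "nat \<Rightarrow> nat \<Rightarrow> nat \<Rightarrow> nat" where
  "owner B R j = (LEAST b. j < b * R div B)"

lemma owner_le_iff:
  assumes "B > 0" "j < R"
  shows "owner B R j \<le> b \<longleftrightarrow> j < b * R div B"
proof
  have "j < B * R div B" using assms by simp
  then have "j < owner B R j * R div B" unfolding owner_def by (rule LeastI)
  also assume "owner B R j \<le> b"
  then have "owner B R j * R div B \<le> b * R div B" by (intro div_le_mono mult_right_mono) auto
  finally show "j < b * R div B" .
next
  assume "j < b * R div B"
  then show "owner B R j \<le> b" unfolding owner_def by (rule Least_le)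
qed

lemma owner_bounds:
  assumes "B > 0" "j < R"
  shows "1 \<le> owner B R j" "owner B R j \<le> B"
  using owner_le_iff[OF assms, of 0] owner_le_iff[OF assms, of B] assms by auto

text \<open>Block \<open>b\<close> owns \<open>R / B\<close> leaves up to the change in the
  fractional part of \<open>b R / B\<close>. Summation by parts turns the error into fractional
  parts times drops \<open>u b - u (Suc b)\<close>, each at most the positive part of the drop. The
  boundary term vanishes at \<open>n = B\<close>.\<close>

lemma sum_owner_ge:
  fixes u :: "nat \<Rightarrow> real"
  assumes B: "B > 0" and nB: "n \<le> B" and u: "\<And>b. u b \<ge> 0"
  shows "(\<Sum>j<n * R div B. u (owner B R j)) + (\<Sum>b\<in>{1..<n}. max 0 (u b - u (Suc b)))
    \<ge> real R / real B * (\<Sum>b\<in>{1..n}. u b) - (real (n * R) / real B - real (n * R div B)) * u n"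
  using nB
proof (induction n)
  case 0
  then show ?case by simp
next
  case (Suc n)
  let ?F = "\<lambda>n. n * R div B" and ?f = "\<lambda>n. real (n * R) / real B - real (n * R div B)"
  have FR: "?F (Suc n) \<le> R"
  proof -
    have "Suc n * R div B \<le> B * R div B"
      using Suc.prems by (intro div_le_mono mult_right_mono) auto
    then show ?thesis using B by simp
  qed
  have FF: "?F n \<le> ?F (Suc n)" by (intro div_le_mono) simp
  have "owner B R j = Suc n" if "j \<in> {?F n..<?F (Suc n)}" for j
  proof -
    have "j < R" using that FR by simp
    then have "owner B R j \<le> Suc n" "\<not> owner B R j \<le> n"
      using that by (auto simp: owner_le_iff[OF B])
    then show ?thesis by simp
  qed
  then have "(\<Sum>j\<in>{?F n..<?F (Suc n)}. u (owner B R j)) = (real (?F (Suc n)) - real (?F n)) * u (Suc n)"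
    using FF by (simp add: of_nat_diff)
  moreover have "(\<Sum>j<?F (Suc n). u (owner B R j)) = (\<Sum>j<?F n. u (owner B R j)) + (\<Sum>j\<in>{?F n..<?F (Suc n)}. u (owner B R j))"
    using sum.atLeastLessThan_concat[OF le0 FF, of "\<lambda>j. u (owner B R j)"]
    by (simp only: lessThan_atLeast0)
  ultimately have s1: "(\<Sum>j<?F (Suc n). u (owner B R j)) = (\<Sum>j<?F n. u (owner B R j)) + (real (?F (Suc n)) - real (?F n)) * u (Suc n)"
    by simp
  have f: "0 \<le> ?f n" "?f n \<le> 1"
  proof -
    have "real (n * R div B) = of_int \<lfloor>real (n * R) / real B\<rfloor>"
      by (simp only: floor_divide_of_nat_eq of_int_of_nat_eq)
    then show "0 \<le> ?f n" "?f n \<le> 1" by linarith+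
  qed
  have key: "?f n * (u n - u (Suc n)) \<le> max 0 (u n - u (Suc n))"
  proof (cases "u n - u (Suc n) \<ge> 0")
    case True then show ?thesis using f mult_left_le_one_le[of "u n - u (Suc n)" "?f n"] by simp
  next
    case False then show ?thesis using f by (simp add: mult_nonneg_nonpos)
  qed
  \<comment> \<open>No drop leads into block \<open>1\<close>: for \<open>n = 0\<close> the term is
    absent, and the fractional part is \<open>0\<close> as well.\<close>
  have s2: "(\<Sum>b\<in>{1..<Suc n}. max 0 (u b - u (Suc b))) =
     (\<Sum>b\<in>{1..<n}. max 0 (u b - u (Suc b))) + (if n = 0 then 0 else max 0 (u n - u (Suc n)))"
    by (cases n) auto
  have e: "?f n * (u n - u (Suc n)) \<le> (if n = 0 then 0 else max 0 (u n - u (Suc n)))"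
    using key by simp
  have fS: "?f (Suc n) = ?f n + real R / real B - (real (?F (Suc n)) - real (?F n))"
    by (simp add: add_divide_distrib algebra_simps)
  have s3: "(\<Sum>b\<in>{1..Suc n}. u b) = (\<Sum>b\<in>{1..n}. u b) + u (Suc n)" by simp
  show ?case unfolding s1 s2 s3 fS using Suc e
    by (simp only: algebra_simps) linarith
qed

text \<open>The tree has \<open>k * Suc B\<close> inner vertices, cut into blocks of \<open>k\<close>, of which block \<open>0\<close> is fixed; they
  form a tight path. After them come \<open>R\<close> leaves, each joined to a whole block. Vertex \<open>i\<close> closes a face
  with the \<open>k\<close> earlier vertices in \<open>attach k B R i\<close>.\<close>

definition attach :: "nat \<Rightarrow> nat \<Rightarrow> nat \<Rightarrow> nat \<Rightarrow> nat set" where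
  "attach k B R i = (if i < k * Suc B then {i - k..<i}
     else let b = owner B R (i - k * Suc B) in {k * b..<k * Suc b})"

lemma attach_root: "attach k B R (k * Suc B + j) = {k * owner B R j..<k * Suc (owner B R j)}"
  by (simp add: attach_def Let_def)

lemma attach_root_block:
  assumes "k > 0" "B > 0" "k * Suc B \<le> i" "i < k * Suc B + R"
  obtains b where "1 \<le> b" "b \<le> B" "attach k B R i = {k * b..<k * Suc b}"
proof -
  obtain j where j: "i = k * Suc B + j" using assms(3) le_Suc_ex by blast
  then have "j < R" using assms by simp
  with owner_bounds[OF assms(2)] that show thesis by (metis attach_root j)
qed

lemma card_attach:
  assumes "k > 0" "k \<le> i"
  shows "card (attach k B R i) = k" "finite (attach k B R i)"
  using assms by (simp_all add: attach_def Let_def)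

lemma attach_below:
  assumes "k > 0" "B > 0" "k \<le> i" "i < k * Suc B + R"
  shows "attach k B R i \<subseteq> {..<i}"
proof (cases "i < k * Suc B")
  case False
  then obtain b where b: "b \<le> B" "attach k B R i = {k * b..<k * Suc b}"
    using attach_root_block[of k B i R] assms by auto
  have "k * Suc b \<le> k * Suc B" using b by (intro mult_left_mono) auto
  then have "x < i" if "x < k * Suc b" for x using that False by linarith
  then show ?thesis using b by (simp add: subset_eq)
qed (auto simp: attach_def)

text \<open>This makes the codegree condition applicable when the tree is embedded vertex by vertex:
  the set to be extended already lies in a face. On the path this is the face closed by
  \<open>i - 1\<close>, for a leaf the one closed by the last vertex of its block.\<close>

lemma attach_extends:
  assumes "k > 0" "B > 0" "k \<le> i" "i < k * Suc B + R"
  shows "attach k B R i = {..<k} \<or> (\<exists>j\<in>{k..<i}. attach k B R i \<subseteq> insert j (attach k B R j))"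
proof (cases "i < k * Suc B")
  case True
  show ?thesis
  proof (cases "i = k")
    case True then show ?thesis using assms by (auto simp: attach_def)
  next
    case False
    then have "attach k B R i \<subseteq> insert (i - 1) (attach k B R (i - 1))"
      using True assms by (auto simp: attach_def)
    then show ?thesis using False assms by (intro disjI2 bexI[of _ "i - 1"]) auto
  qed
next
  case False
  then obtain b where b: "1 \<le> b" "b \<le> B" "attach k B R i = {k * b..<k * Suc b}"
    using attach_root_block[of k B i R] assms by auto
  define j where "j = k * Suc b - 1"
  have le: "k * Suc b \<le> k * Suc B" using b by (intro mult_left_mono) auto
  have "k * 1 \<le> k * b" using b by (intro mult_left_mono) auto
  then have j: "k \<le> j" "j < k * Suc B" "j < i"
    using le assms False unfolding j_def mult_Suc_right mult_1_right by linarith+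
  then have "attach k B R i \<subseteq> insert j (attach k B R j)"
    using b(3) assms(1) by (auto simp: attach_def j_def)
  then show ?thesis using j by auto
qed

lemma sum_blocks:
  fixes g :: "nat \<Rightarrow> real"
  shows "(\<Sum>b\<in>{1..<Suc B}. \<Sum>i\<in>{k * b..<k * Suc b}. g i) = (\<Sum>i\<in>{k..<k * Suc B}. g i)"
proof (induction B)
  case (Suc B)
  have "(\<Sum>i\<in>{k..<k * Suc B}. g i) + (\<Sum>i\<in>{k * Suc B..<k * Suc (Suc B)}. g i)
      = (\<Sum>i\<in>{k..<k * Suc (Suc B)}. g i)"
    by (rule sum.atLeastLessThan_concat) auto
  with Suc show ?case by simp
qed simp

text \<open>The floors in \<open>owner\<close> leave a block short of its average share by less than one leaf. The first
  vertex of the next block that lies outside \<open>I\<close> makes up for it.\<close>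

lemma block_deficit:
  assumes k: "k > 0" and b: "1 \<le> b" "b < B" and I: "finite I"
  shows "max 0 (real (card (I \<inter> {k * b..<k * Suc b})) - real (card (I \<inter> {k * Suc b..<k * Suc (Suc b)})))
    \<le> (\<Sum>i\<in>{k * Suc b..<k * Suc (Suc b)}. if i \<in> I then 0 else real (card (attach k B R i \<inter> I)))"
proof (cases "{k * Suc b..<k * Suc (Suc b)} \<subseteq> I")
  case True
  have "card (I \<inter> {k * b..<k * Suc b}) \<le> card {k * b..<k * Suc b}" by (rule card_mono) auto
  moreover have "I \<inter> {k * Suc b..<k * Suc (Suc b)} = {k * Suc b..<k * Suc (Suc b)}" using True by blast
  ultimately have "real (card (I \<inter> {k * b..<k * Suc b})) - real (card (I \<inter> {k * Suc b..<k * Suc (Suc b)})) \<le> 0"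
    by simp
  then show ?thesis by (simp add: sum_nonneg)
next
  case False
  define i where "i = (LEAST i. i \<in> {k * Suc b..<k * Suc (Suc b)} \<and> i \<notin> I)"
  have "i \<in> {k * Suc b..<k * Suc (Suc b)} \<and> i \<notin> I"
    unfolding i_def by (rule LeastI_ex) (use False in blast)
  then have i: "k * Suc b \<le> i" "i < k * Suc (Suc b)" "i \<notin> I" by auto
  have below: "l \<in> I" if "k * Suc b \<le> l" "l < i" for l
    using that i not_less_Least[of l "\<lambda>i. i \<in> {k * Suc b..<k * Suc (Suc b)} \<and> i \<notin> I"]
    unfolding i_def[symmetric] by auto
  have "k * Suc (Suc b) \<le> k * Suc B" using b by (intro mult_left_mono) auto
  then have att: "attach k B R i = {i - k..<i}" using i by (simp add: attach_def)
  have ik: "k * b \<le> i - k" "i - k < k * Suc b" using i by auto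
  \<comment> \<open>The window \<open>{i - k..<i}\<close> omits the first
    \<open>i - k - k * b\<close> vertices of block \<open>b\<close> and gains equally many from the
    next block, all of them in \<open>I\<close>.\<close>
  have "card (I \<inter> {k * b..<k * Suc b}) \<le> card ({k * b..<i - k} \<union> (I \<inter> {i - k..<k * Suc b}))"
    using I by (intro card_mono) auto
  also have "\<dots> \<le> (i - k - k * b) + card (I \<inter> {i - k..<k * Suc b})"
    using card_Un_le[of "{k * b..<i - k}"] by simp
  also have "i - k - k * b = card {k * Suc b..<i}" by (simp add: algebra_simps)
  also have "card {k * Suc b..<i} + card (I \<inter> {i - k..<k * Suc b})
      = card ({k * Suc b..<i} \<union> (I \<inter> {i - k..<k * Suc b}))"
    using I by (intro card_Un_disjoint[symmetric]) auto
  also have "{k * Suc b..<i} \<union> (I \<inter> {i - k..<k * Suc b}) \<subseteq> attach k B R i \<inter> I"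
    using below ik i unfolding att by auto
  then have "card ({k * Suc b..<i} \<union> (I \<inter> {i - k..<k * Suc b})) \<le> card (attach k B R i \<inter> I)"
    using I by (intro card_mono) auto
  finally have "real (card (I \<inter> {k * b..<k * Suc b})) \<le> real (card (attach k B R i \<inter> I))" by simp
  also have "\<dots> = (if i \<in> I then 0 else real (card (attach k B R i \<inter> I)))" using i by simp
  also have "\<dots> \<le> (\<Sum>i\<in>{k * Suc b..<k * Suc (Suc b)}. if i \<in> I then 0 else real (card (attach k B R i \<inter> I)))"
    using i by (intro member_le_sum) auto
  finally show ?thesis by (simp add: sum_nonneg)
qed

text \<open>The right side counts the faces \<open>insert i A\<close> with
  \<open>A \<subseteq> attach k B R i\<close> that meet \<open>I\<close>. A vertex of
  \<open>I\<close> closes \<open>2^k\<close> of them. By concavity any other vertex gives at least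
  \<open>(2^k - 1) / k\<close> per neighbour in \<open>I\<close>, and leaves together with path
  vertices outside \<open>I\<close> supply \<open>R / B\<close> such incidences per vertex of
  \<open>I\<close>.\<close>

lemma attach_balanced:
  assumes k: "k > 0" and B: "B > 0" and I: "I \<subseteq> {k..<k * Suc B}"
  shows "(2 ^ k + (2 ^ k - 1) * real R / real (k * B)) * real (card I)
    \<le> (\<Sum>i\<in>{k..<k * Suc B + R}. if i \<in> I then 2 ^ k else 2 ^ k - 2 ^ (k - card (attach k B R i \<inter> I)))"
proof -
  define c where "c i = real (card (attach k B R i \<inter> I))" for i
  define g where "g i = (if i \<in> I then 0 else c i)" for i
  define u where "u b = real (card (I \<inter> {k * b..<k * Suc b}))" for b
  have finI: "finite I" using I finite_subset by blast
  have kB: "k \<le> k * Suc B" by simp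
  have ind: "real (card I) = (\<Sum>i\<in>{k..<k * Suc B}. if i \<in> I then 1 else 0)"
    using I by (simp add: sum.If_cases Int_absorb1)
  have sum_u: "(\<Sum>b\<in>{1..B}. u b) = real (card I)"
  proof -
    have "u b = (\<Sum>i\<in>{k * b..<k * Suc b}. if i \<in> I then 1 else 0)" for b
      by (simp add: u_def sum.If_cases Int_commute)
    then show ?thesis unfolding ind sum_blocks[symmetric]
      by (simp add: atLeastLessThanSuc_atLeastAtMost)
  qed
  have z: "(\<Sum>b\<in>{1..<B}. max 0 (u b - u (Suc b))) \<le> (\<Sum>i\<in>{k..<k * Suc B}. g i)"
  proof -
    have g0: "g i \<ge> 0" for i by (simp add: g_def c_def)
    have "(\<Sum>b\<in>{1..<B}. max 0 (u b - u (Suc b))) \<le> (\<Sum>b\<in>{1..<B}. \<Sum>i\<in>{k * Suc b..<k * Suc (Suc b)}. g i)"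
      unfolding u_def g_def c_def by (intro sum_mono block_deficit k finI) auto
    also have "\<dots> = (\<Sum>b\<in>{Suc 1..<Suc B}. \<Sum>i\<in>{k * b..<k * Suc b}. g i)"
      by (simp only: sum.shift_bounds_Suc_ivl)
    also have "\<dots> \<le> (\<Sum>b\<in>{1..<Suc B}. \<Sum>i\<in>{k * b..<k * Suc b}. g i)"
      using g0 by (intro sum_mono2 sum_nonneg) auto
    finally show ?thesis by (simp only: sum_blocks)
  qed
  \<comment> \<open>A leaf is never in \<open>I\<close>, so its term is the number of vertices of
    \<open>I\<close> in the block that owns it.\<close>
  have roots: "(\<Sum>i\<in>{k * Suc B..<k * Suc B + R}. g i) = (\<Sum>j<R. u (owner B R j))"
  proof -
    have "(\<Sum>i\<in>{k * Suc B..<k * Suc B + R}. g i) = (\<Sum>j<R. g (k * Suc B + j))"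
      using sum.shift_bounds_nat_ivl[of g 0 "k * Suc B" R] by (simp add: lessThan_atLeast0 add.commute)
    moreover have "g (k * Suc B + j) = u (owner B R j)" for j
      using I by (auto simp: g_def c_def u_def attach_root Int_commute simp del: mult_Suc_right)
    ultimately show ?thesis by simp
  qed
  have u0: "u b \<ge> 0" for b by (simp add: u_def)
  have "real R / real B * real (card I) \<le> (\<Sum>j<R. u (owner B R j)) + (\<Sum>b\<in>{1..<B}. max 0 (u b - u (Suc b)))"
    using sum_owner_ge[OF B order_refl, of u R, OF u0, unfolded sum_u] B by simp
  also have "\<dots> \<le> (\<Sum>i\<in>{k..<k * Suc B + R}. g i)"
    using z roots sum.atLeastLessThan_concat[OF kB, of "k * Suc B + R" g] by linarith
  finally have main: "real R / real B * real (card I) \<le> (\<Sum>i\<in>{k..<k * Suc B + R}. g i)" .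
  have step: "(if i \<in> I then 2 ^ k else 0) + (2 ^ k - 1) / real k * g i
      \<le> (if i \<in> I then 2 ^ k else 2 ^ k - 2 ^ (k - card (attach k B R i \<inter> I)))"
    if "i \<in> {k..<k * Suc B + R}" for i
  proof -
    have "card (attach k B R i \<inter> I) \<le> k"
      using card_attach[OF k, of i B R] that card_mono[of "attach k B R i" "attach k B R i \<inter> I"] by auto
    then have "(2 ^ k - 1) * c i \<le> real k * (2 ^ k - 2 ^ (k - card (attach k B R i \<inter> I)))"
      using power_diff_concave[of "card (attach k B R i \<inter> I)" k] by (simp add: c_def mult.commute)
    then show ?thesis using k by (simp add: g_def field_simps)
  qed
  have "(2 ^ k + (2 ^ k - 1) * real R / real (k * B)) * real (card I)
      = 2 ^ k * real (card I) + (2 ^ k - 1) / real k * (real R / real B * real (card I))"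
    by (simp add: field_simps)
  also have "\<dots> \<le> 2 ^ k * real (card I) + (2 ^ k - 1) / real k * (\<Sum>i\<in>{k..<k * Suc B + R}. g i)"
    by (intro add_left_mono mult_left_mono main) simp
  also have "2 ^ k * real (card I) = (\<Sum>i\<in>{k..<k * Suc B + R}. if i \<in> I then 2 ^ k else 0)"
  proof -
    have "{k..<k * Suc B + R} \<inter> I = I" using I by auto
    then show ?thesis by (simp add: sum.If_cases)
  qed
  also have "\<dots> + (2 ^ k - 1) / real k * (\<Sum>i\<in>{k..<k * Suc B + R}. g i)
      = (\<Sum>i\<in>{k..<k * Suc B + R}. (if i \<in> I then 2 ^ k else 0) + (2 ^ k - 1) / real k * g i)"
    by (simp add: sum.distrib sum_distrib_left)
  also have "\<dots> \<le> (\<Sum>i\<in>{k..<k * Suc B + R}. if i \<in> I then 2 ^ k else 2 ^ k - 2 ^ (k - card (attach k B R i \<inter> I)))"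
    by (intro sum_mono step)
  finally show ?thesis .
qed

subsection \<open>Copies of the tree\<close>

text \<open>Extensional functions make the copies finite in number and easy to count.
  \<open>N\<close> is any prefix length, so that copies grow one vertex at a time; \<open>h0\<close>
  prescribes the first block, which closes no face.\<close>

definition tree_copies ::
    "(nat \<Rightarrow> nat set) \<Rightarrow> 'a set \<Rightarrow> 'a set set \<Rightarrow> nat \<Rightarrow> (nat \<Rightarrow> 'a) \<Rightarrow> nat \<Rightarrow> (nat \<Rightarrow> 'a) set" where
  "tree_copies att V H k h0 N = {h \<in> {..<N} \<rightarrow>\<^sub>E V. inj_on h {..<N} \<and> (\<forall>i<k. h i = h0 i) \<and>
     (\<forall>i\<in>{k..<N}. h ` insert i (att i) \<in> H)}"

lemma finite_tree_copies: "finite V \<Longrightarrow> finite (tree_copies att V H k h0 N)"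
  by (rule finite_subset[of _ "{..<N} \<rightarrow>\<^sub>E V"]) (auto simp: tree_copies_def intro: finite_PiE)

lemma tree_copies_Suc:
  assumes h: "h \<in> tree_copies att V H k h0 N" and HV: "H \<subseteq> Pow V" and kN: "k \<le> N"
    and att: "\<And>i. k \<le> i \<Longrightarrow> i \<le> N \<Longrightarrow> att i \<subseteq> {..<i}"
    and y: "insert y (h ` att N) \<in> H" "y \<notin> h ` {..<N}"
  shows "h(N := y) \<in> tree_copies att V H k h0 (Suc N)"
proof -
  have "y \<in> V" using y HV by auto
  then have "h(N := y) \<in> {..<Suc N} \<rightarrow>\<^sub>E V"
    using h by (auto simp: tree_copies_def PiE_def extensional_def Pi_def)
  moreover have "inj_on (h(N := y)) {..<Suc N}"
    using h y by (auto simp: tree_copies_def inj_on_def less_Suc_eq)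
  moreover have "(h(N := y)) ` insert i (att i) \<in> H" if i: "i \<in> {k..<Suc N}" for i
  proof (cases "i = N")
    case True
    have "N \<notin> att N" using att[of N] kN by auto
    then have "(h(N := y)) ` att N = h ` att N" by auto
    then show ?thesis using y by (simp only: True image_insert fun_upd_same)
  next
    case False
    then have "insert i (att i) \<subseteq> {..<N}" using att[of i] i by auto
    then have "(h(N := y)) ` insert i (att i) = h ` insert i (att i)"
      by (intro image_cong) auto
    then show ?thesis using h i False by (simp add: tree_copies_def)
  qed
  moreover have "\<forall>i<k. (h(N := y)) i = h0 i" using h kN by (auto simp: tree_copies_def)
  ultimately show ?thesis unfolding tree_copies_def by blast
qed

text \<open>Greedy embedding: the image of \<open>att N\<close> lies in a member of
  \<open>H\<close>, hence has at least \<open>D\<close> extensions, of which at most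
  \<open>N < L\<close> are already used.\<close>

lemma card_tree_copies_ge:
  fixes D :: real
  assumes V: "finite V" and HV: "H \<subseteq> Pow V" and unif: "\<And>E. E \<in> H \<Longrightarrow> card E = Suc k"
    and deg: "\<And>E Q. E \<in> H \<Longrightarrow> Q \<subseteq> E \<Longrightarrow> card Q = k \<Longrightarrow> D \<le> real (card {y. insert y Q \<in> H})"
    and h0: "inj_on h0 {..<k}" "h0 ` {..<k} \<subseteq> E0" "E0 \<in> H"
    and att: "\<And>i. k \<le> i \<Longrightarrow> i < L \<Longrightarrow> att i \<subseteq> {..<i}"
      "\<And>i. k \<le> i \<Longrightarrow> i < L \<Longrightarrow> card (att i) = k"
      "\<And>i. k \<le> i \<Longrightarrow> i < L \<Longrightarrow> att i = {..<k} \<or> (\<exists>j\<in>{k..<i}. att i \<subseteq> insert j (att j))"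
    and "k \<le> N" "N \<le> L" and LD: "real L \<le> D"
  shows "(D - real L) ^ (N - k) \<le> real (card (tree_copies att V H k h0 N))"
  using \<open>k \<le> N\<close> \<open>N \<le> L\<close>
proof (induction N rule: dec_induct)
  case base
  have "h0 ` {..<k} \<subseteq> V" using h0 HV by blast
  then have "restrict h0 {..<k} \<in> tree_copies att V H k h0 k"
    using h0(1) by (auto simp: tree_copies_def inj_on_def)
  then have "tree_copies att V H k h0 k \<noteq> {}" by blast
  then have "0 < card (tree_copies att V H k h0 k)"
    using finite_tree_copies[OF V] by (simp add: card_gt_0_iff)
  then show ?case by simp
next
  case (step N)
  let ?T = "tree_copies att V H k h0 N"
  define Y where "Y h = {y. insert y (h ` att N) \<in> H} - h ` {..<N}" for h
  have N: "k \<le> N" "N < L" using step by auto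
  have finY: "finite (Y h)" for h
  proof (rule finite_subset[OF _ V])
    show "Y h \<subseteq> V" using HV by (auto simp: Y_def)
  qed
  have Y: "D - real L \<le> real (card (Y h))" if h: "h \<in> ?T" for h
  proof -
    have inj: "inj_on h {..<N}" using h by (simp add: tree_copies_def)
    have "\<exists>E\<in>H. h ` att N \<subseteq> E"
      using att(3)[OF N]
    proof
      assume "att N = {..<k}"
      moreover have "h ` {..<k} = h0 ` {..<k}" using h by (auto simp: tree_copies_def)
      ultimately show ?thesis using h0 by auto
    next
      assume "\<exists>j\<in>{k..<N}. att N \<subseteq> insert j (att j)"
      then obtain j where "j \<in> {k..<N}" "att N \<subseteq> insert j (att j)" by blast
      then show ?thesis using h by (intro bexI[of _ "h ` insert j (att j)"]) (auto simp: tree_copies_def)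
    qed
    moreover have "card (h ` att N) = k"
      using att(1,2)[OF N] inj by (metis card_image inj_on_subset)
    ultimately have "D \<le> real (card {y. insert y (h ` att N) \<in> H})" using deg by blast
    moreover have "card {y. insert y (h ` att N) \<in> H} - card (h ` {..<N}) \<le> card (Y h)"
      unfolding Y_def by (rule diff_card_le_card_Diff) simp
    moreover have "card (h ` {..<N}) = N" using inj by (simp add: card_image)
    ultimately show ?thesis using N by linarith
  qed
  have "(D - real L) ^ (Suc N - k) = (D - real L) ^ (N - k) * (D - real L)"
    using N by (simp add: Suc_diff_le)
  also have "\<dots> \<le> real (card ?T) * (D - real L)"
    using step LD by (intro mult_right_mono) auto
  also have "\<dots> = (\<Sum>h\<in>?T. D - real L)" by simp
  also have "\<dots> \<le> (\<Sum>h\<in>?T. real (card (Y h)))" by (intro sum_mono Y)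
  also have "\<dots> = real (card (Sigma ?T Y))"
    using finite_tree_copies[OF V] finY by (simp add: card_SigmaI)
  also have "\<dots> \<le> real (card (tree_copies att V H k h0 (Suc N)))"
  proof -
    have "inj_on (\<lambda>(h, y). h(N := y)) (Sigma ?T Y)"
    proof (rule inj_onI, clarify)
      fix h y h' y'
      assume "h \<in> ?T" "h' \<in> ?T" and eq: "h(N := y) = h'(N := y')"
      then have "h N = undefined" "h' N = undefined"
        by (auto simp: tree_copies_def PiE_def extensional_def)
      moreover have "y = y'" using fun_cong[OF eq, of N] by simp
      moreover have "h i = h' i" if "i \<noteq> N" for i using fun_cong[OF eq, of i] that by simp
      ultimately show "h = h' \<and> y = y'" by (metis ext)
    qed
    moreover have "(\<lambda>(h, y). h(N := y)) ` Sigma ?T Y \<subseteq> tree_copies att V H k h0 (Suc N)"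
      using tree_copies_Suc[OF _ HV N(1)] att(1) N by (auto simp: Y_def)
    ultimately have "card (Sigma ?T Y) \<le> card (tree_copies att V H k h0 (Suc N))"
      by (rule card_inj_on_le) (rule finite_tree_copies[OF V])
    then show ?thesis by simp
  qed
  finally show ?case .
qed

definition faces :: "'a set set \<Rightarrow> 'a set \<Rightarrow> 'a set set" where
  "faces D U = {F \<in> D. F \<subseteq> U}"

text \<open>Every image of \<open>insert i A\<close> with \<open>A \<subseteq> att i\<close> is a
  face, and these are distinct because \<open>i\<close> is the largest label. It lies outside
  \<open>U\<close> as soon as \<open>insert i A\<close> meets \<open>I\<close>; for \<open>i\<close>
  outside \<open>I\<close> this excludes just the subsets of \<open>att i - I\<close>.\<close>

lemma card_faces_copy_ge:
  assumes V: "finite V" and DV: "D \<subseteq> Pow V" and down: "\<And>A B. A \<in> D \<Longrightarrow> B \<subseteq> A \<Longrightarrow> B \<in> D"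
    and HD: "H \<subseteq> D" and h: "h \<in> tree_copies att V H k h0 N"
    and att: "\<And>i. k \<le> i \<Longrightarrow> i < N \<Longrightarrow> att i \<subseteq> {..<i}"
      "\<And>i. k \<le> i \<Longrightarrow> i < N \<Longrightarrow> card (att i) = k"
    and I: "I = {i \<in> {..<N}. h i \<notin> U}"
  shows "real (card (faces D U)) + (\<Sum>i\<in>{k..<N}. if i \<in> I then 2 ^ k else 2 ^ k - 2 ^ (k - card (att i \<inter> I)))
    \<le> real (card (faces D (U \<union> h ` {..<N})))"
proof -
  define P where "P i = {A \<in> Pow (att i). insert i A \<inter> I \<noteq> {}}" for i
  define \<phi> where "\<phi> = (\<lambda>(i, A). h ` insert i A)"
  have inj: "inj_on h {..<N}" using h by (simp add: tree_copies_def)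
  have finD: "finite D" using V DV finite_subset by blast
  have fin_att: "finite (att i)" if "k \<le> i" "i < N" for i
    using att(1)[OF that] finite_subset by blast
  have cardP: "real (card (P i)) = (if i \<in> I then 2 ^ k else 2 ^ k - 2 ^ (k - card (att i \<inter> I)))"
    if i: "i \<in> {k..<N}" for i
  proof -
    have fa: "finite (att i)" and ca: "card (att i) = k" using fin_att att(2) i by auto
    show ?thesis
    proof (cases "i \<in> I")
      case True
      then have "P i = Pow (att i)" by (auto simp: P_def)
      then show ?thesis using fa ca True by (simp add: card_Pow)
    next
      case False
      then have "P i = Pow (att i) - Pow (att i - I)" by (auto simp: P_def)
      then have "card (P i) = card (Pow (att i)) - card (Pow (att i - I))"
        using fa by (simp add: card_Diff_subset Pow_mono)
      also have "card (att i - I) = k - card (att i \<inter> I)" using fa ca by (simp add: card_Diff_subset_Int)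
      then have "card (Pow (att i)) - card (Pow (att i - I)) = 2 ^ k - 2 ^ (k - card (att i \<inter> I))"
        using fa ca by (simp add: card_Pow)
      finally show ?thesis using False by (simp add: of_nat_diff)
    qed
  qed
  have sub: "insert i A \<subseteq> {..<N}" if "i \<in> {k..<N}" "A \<in> P i" for i A
    using that att(1)[of i] by (auto simp: P_def)
  have "inj_on \<phi> (Sigma {k..<N} P)"
  proof (rule inj_onI, clarify)
    fix i A j B
    assume iA: "i \<in> {k..<N}" "A \<in> P i" and jB: "j \<in> {k..<N}" "B \<in> P j"
      and "\<phi> (i, A) = \<phi> (j, B)"
    then have eq: "insert i A = insert j B"
      using inj_on_image_eq_iff[OF inj sub[OF iA] sub[OF jB]] by (simp add: \<phi>_def)
    have "\<forall>l\<in>A. l < i" "\<forall>l\<in>B. l < j"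
      using iA jB att(1)[of i] att(1)[of j] by (auto simp: P_def)
    with eq show "i = j \<and> A = B"
      by (metis insertE insertI1 insert_ident less_irrefl less_asym)
  qed
  then have "card (Sigma {k..<N} P) = card (\<phi> ` Sigma {k..<N} P)" by (simp add: card_image)
  also have "\<dots> \<le> card (faces D (U \<union> h ` {..<N}) - faces D U)"
  proof (rule card_mono)
    show "finite (faces D (U \<union> h ` {..<N}) - faces D U)" using finD by (simp add: faces_def)
    show "\<phi> ` Sigma {k..<N} P \<subseteq> faces D (U \<union> h ` {..<N}) - faces D U"
    proof clarify
      fix i A assume iA: "i \<in> {k..<N}" "A \<in> P i"
      have "h ` insert i (att i) \<in> D" using h HD iA by (auto simp: tree_copies_def)
      moreover have "h ` insert i A \<subseteq> h ` insert i (att i)" using iA by (auto simp: P_def)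
      ultimately have "\<phi> (i, A) \<in> D" using down by (simp add: \<phi>_def)
      moreover have "\<phi> (i, A) \<subseteq> U \<union> h ` {..<N}" using sub[OF iA] by (auto simp: \<phi>_def)
      moreover have "\<not> \<phi> (i, A) \<subseteq> U" using iA I by (auto simp: \<phi>_def P_def)
      ultimately show "\<phi> (i, A) \<in> faces D (U \<union> h ` {..<N}) - faces D U" by (simp add: faces_def)
    qed
  qed
  also have "\<dots> = card (faces D (U \<union> h ` {..<N})) - card (faces D U)"
    using finD by (intro card_Diff_subset) (auto simp: faces_def)
  finally have "card (Sigma {k..<N} P) \<le> card (faces D (U \<union> h ` {..<N})) - card (faces D U)" .
  moreover have "card (faces D U) \<le> card (faces D (U \<union> h ` {..<N}))"
    using finD by (intro card_mono) (auto simp: faces_def)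
  moreover have "finite (P i)" if "i \<in> {k..<N}" for i using fin_att that by (simp add: P_def)
  then have "real (card (Sigma {k..<N} P)) = (\<Sum>i\<in>{k..<N}. real (card (P i)))"
    by (simp add: card_SigmaI)
  then have "real (card (Sigma {k..<N} P)) = (\<Sum>i\<in>{k..<N}. if i \<in> I then 2 ^ k else 2 ^ k - 2 ^ (k - card (att i \<inter> I)))"
    using cardP by simp
  ultimately show ?thesis by linarith
qed

subsection \<open>Complexes without dense spots\<close>

text \<open>The bounds on \<open>p\<close> say \<open>t = \<lfloor>log 2 s\<rfloor>\<close>. Since
  \<open>q s = p\<close>, the hypothesis of the theorem, weakened by \<open>t \<le> log 2 s\<close>,
  factors as \<open>s (m - 3 p t)\<close>.\<close>

locale sparse_complex =
  fixes V :: "'a set" and D :: "'a set set" and m p q t :: nat and s :: real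
  assumes finite_V: "finite V" and D_subset: "D \<subseteq> Pow V"
    and down: "\<And>A B. A \<in> D \<Longrightarrow> B \<subseteq> A \<Longrightarrow> B \<in> D"
    and m_le: "m \<le> card V" and t_pos: "t \<ge> 1" and q_pos: "q > 0"
    and p_ge: "2 ^ t * q \<le> p" and p_less: "p < 2 ^ Suc t * q"
    and s_def: "s = real p / real q"
    and sparse: "\<And>U. U \<subseteq> V \<Longrightarrow> card U \<le> m \<Longrightarrow> real (card (faces D U)) \<le> s * (real m - 3 * real p * real t)"
begin

lemma p_ge_2q: "2 * q \<le> p"
proof -
  have "(2 :: nat) ^ 1 \<le> 2 ^ t" using t_pos by (intro power_increasing) auto
  then have "2 * q \<le> 2 ^ t * q" by (intro mult_right_mono) auto
  then show ?thesis using p_ge by linarith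
qed

lemma p_pos: "p > 0" using p_ge_2q q_pos by linarith

lemma s_pos: "s > 0" using p_pos q_pos by (simp add: s_def)

text \<open>The number of faces inside the empty set is nonnegative, so the sparsity bound must be
  too.\<close>

lemma m_ge: "3 * (p * t) \<le> m"
proof -
  have "0 \<le> s * (real m - 3 * real p * real t)" using sparse[of "{}"] by (simp add: order_trans[rotated])
  then have "3 * real p * real t \<le> real m" using s_pos by (simp add: zero_le_mult_iff)
  then show ?thesis by (metis (no_types) mult.assoc of_nat_le_iff of_nat_mult of_nat_numeral)
qed

lemma m_pos: "m > 0" using m_ge p_pos t_pos by (cases m) auto

lemma finite_D: "finite D"
  using finite_V D_subset finite_subset by blast

text \<open>Equals \<open>(s - 2^k) / (s - 1)\<close>, the share of leaves among the tree vertices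
  outside block \<open>0\<close>.\<close>

definition codegree_exponent :: "nat \<Rightarrow> real" where
  "codegree_exponent k = (real p - 2 ^ k * real q) / (real p - real q)"

text \<open>Copies of the tree with a common image of the first block and of the leaves attached to the
  blocks accumulate at least \<open>s\<close> faces per new vertex, until about \<open>m\<close> vertices are used.\<close>

lemma no_dense_subfamily:
  assumes k: "1 \<le> k" "k \<le> t" and HD: "H \<subseteq> D" and ne: "H \<noteq> {}"
    and unif: "\<And>E. E \<in> H \<Longrightarrow> card E = Suc k"
    and deg: "\<And>E Q. E \<in> H \<Longrightarrow> Q \<subseteq> E \<Longrightarrow> card Q = k \<Longrightarrow>
      2 * real m * real (card V) powr codegree_exponent k \<le> real (card {y. insert y Q \<in> H})"
  shows False
proof -
  define n where "n = card V"
  \<comment> \<open>These sizes give \<open>(2^k - 1) R / (k B) = p / q - 2^k\<close>, so the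
    balance constant of the tree is exactly \<open>s\<close>.\<close>
  define B where "B = q * (2 ^ k - 1)"
  define R where "R = k * (p - 2 ^ k * q)"
  define M where "M = k * B"
  define N where "N = k * Suc B + R"
  define e where "e = k * (p - q)"
  define \<delta> where "\<delta> = codegree_exponent k"
  define att where "att = attach k B R"
  have n: "n \<ge> 1" "real n \<ge> 1" using m_le m_pos by (auto simp: n_def)
  have k0: "k > 0" using k by simp
  have pk: "2 ^ k * q \<le> p"
  proof -
    have "(2 :: nat) ^ k \<le> 2 ^ t" using k by (intro power_increasing) auto
    then have "2 ^ k * q \<le> 2 ^ t * q" by (intro mult_right_mono) auto
    then show ?thesis using p_ge by linarith
  qed
  have two_k: "(2 :: nat) ^ k \<ge> 2" using power_increasing[of 1 k "2 :: nat"] k by simp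
  then have B0: "B > 0" using q_pos by (simp add: B_def)
  have pq: "q < p" using p_ge_2q q_pos by linarith
  have "B + (p - 2 ^ k * q) = p - q"
    using pk two_k q_pos by (simp add: B_def diff_mult_distrib2 mult.commute)
  then have Me: "M + R = e"
    by (simp add: M_def R_def e_def flip: distrib_left)
  have Ne: "N = k + e" using Me by (simp add: N_def M_def)
  have "Suc (p - q) \<le> p" using q_pos p_pos by linarith
  then have "k * Suc (p - q) \<le> t * p" using k by (intro mult_mono) auto
  then have N_le: "N \<le> p * t" by (simp add: Ne e_def mult.commute)
  have pt: "0 < p * t" using p_pos t_pos by simp
  have Nm: "N < m" using N_le m_ge pt by linarith
  have e0: "e > 0" using k0 pq by (simp add: e_def)
  have s_eq: "2 ^ k + (2 ^ k - 1) * real R / real (k * B) = s"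
  proof -
    have "real R = real k * (real p - 2 ^ k * real q)" using pk by (simp add: R_def of_nat_diff)
    moreover have "real (k * B) = real k * (real q * (2 ^ k - 1))"
      using two_k by (simp add: B_def of_nat_diff)
    moreover have "(2 :: real) ^ k \<ge> 2" using power_increasing[of 1 k "2 :: real"] k by simp
    then have "(2 :: real) ^ k - 1 \<noteq> 0" by linarith
    ultimately have "(2 ^ k - 1) * real R / real (k * B) = (real p - 2 ^ k * real q) / real q"
      using k0 by simp
    then show ?thesis using q_pos by (simp add: s_def field_simps)
  qed
  have \<delta>e: "\<delta> * real e = real R"
    using pk pq by (simp add: \<delta>_def codegree_exponent_def e_def R_def of_nat_diff field_simps)
  have \<delta>0: "\<delta> \<ge> 0"
  proof -
    have "real (2 ^ k * q) \<le> real p" using pk of_nat_le_iff by blast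
    then show ?thesis using pq by (simp add: \<delta>_def codegree_exponent_def)
  qed
  have n\<delta>: "real n powr \<delta> \<ge> 1" using n \<delta>0 by (simp add: ge_one_powr_ge_zero)

  have att: "att i \<subseteq> {..<i}" "card (att i) = k"
      "att i = {..<k} \<or> (\<exists>j\<in>{k..<i}. att i \<subseteq> insert j (att j))" if "k \<le> i" "i < N" for i
    using attach_below[OF k0 B0, of i R] card_attach[OF k0, of i B R] attach_extends[OF k0 B0, of i R] that
    by (auto simp: att_def N_def)

  obtain E0 where E0: "E0 \<in> H" using ne by blast
  have "finite E0" using unif[OF E0] card.infinite by fastforce
  obtain Q0 where Q0: "Q0 \<subseteq> E0" "card Q0 = k"
    using obtain_subset_with_card_n[of k E0] unif[OF E0] by auto
  then have "finite Q0" using \<open>finite E0\<close> finite_subset by blast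
  then obtain h0 where h0: "bij_betw h0 {..<k} Q0"
    using Q0 ex_bij_betw_nat_finite[of Q0] by (auto simp: lessThan_atLeast0)
  define T where "T = tree_copies att V H k h0 N"
  have HV: "H \<subseteq> Pow V" using HD D_subset by blast
  \<comment> \<open>The factor \<open>2\<close> in the codegree pays for the \<open>N < m\<close>
    vertices that a greedy embedding must avoid.\<close>
  have DN: "real m * real n powr \<delta> < 2 * real m * real n powr \<delta> - real N"
  proof -
    have "real N < real m * 1" using Nm by simp
    also have "\<dots> \<le> real m * real n powr \<delta>" using n\<delta> by (intro mult_left_mono) auto
    finally show ?thesis by simp
  qed
  have "(2 * real m * real n powr \<delta> - real N) ^ e \<le> real (card T)"
  proof -
    have "(2 * real m * real n powr \<delta> - real N) ^ (N - k) \<le> real (card T)"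
      unfolding T_def
    proof (rule card_tree_copies_ge[OF finite_V HV unif])
      show "2 * real m * real n powr \<delta> \<le> real (card {y. insert y Q \<in> H})"
        if "E \<in> H" "Q \<subseteq> E" "card Q = k" for E Q
        using deg[OF that] by (simp add: n_def \<delta>_def)
      show "inj_on h0 {..<k}" "h0 ` {..<k} \<subseteq> E0" using h0 Q0 by (auto simp: bij_betw_def)
      have "0 \<le> real m * real n powr \<delta>" by simp
      then show "real N \<le> 2 * real m * real n powr \<delta>" using DN by linarith
    qed (use att E0 Ne in auto)
    then show ?thesis by (simp add: Ne)
  qed
  \<comment> \<open>Because \<open>\<delta> e = R\<close>, the power \<open>(m n^\<delta>)^e\<close>
    equals \<open>m^e n^R\<close>, and \<open>M \<le> e\<close>.\<close>
  moreover have "real (n ^ R * m ^ M) < (2 * real m * real n powr \<delta> - real N) ^ e"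
  proof -
    have "(real n powr \<delta>) ^ e = real n powr (\<delta> * real e)"
      using n by (simp add: powr_powr flip: powr_realpow)
    also have "\<dots> = real n ^ R" using n by (simp add: \<delta>e powr_realpow)
    finally have ne: "(real n powr \<delta>) ^ e = real n ^ R" .
    have "real m ^ M \<le> real m ^ e" using m_pos Me by (intro power_increasing) auto
    then have "real (n ^ R * m ^ M) \<le> real n ^ R * real m ^ e"
      by (simp add: mult_left_mono)
    also have "\<dots> = (real m * real n powr \<delta>) ^ e" by (simp add: power_mult_distrib ne)
    also have "\<dots> < (2 * real m * real n powr \<delta> - real N) ^ e"
      using DN e0 by (intro power_strict_mono) auto
    finally show ?thesis .
  qed
  ultimately have cardT: "n ^ R * m ^ M < card T" by (metis less_le_trans of_nat_less_iff)

  define leaves where "leaves = {k * Suc B..<N}"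
  define fiber where "fiber g = {h \<in> T. restrict h leaves = g}" for g
  \<comment> \<open>The leaves can be placed in at most \<open>n^R\<close> ways, so some placement
    is shared by more than \<open>m^M\<close> copies.\<close>
  obtain g where g: "m ^ M < card (fiber g)"
  proof (rule ccontr)
    assume "\<not> thesis"
    then have small: "card (fiber g) \<le> m ^ M" for g using that by (meson not_le)
    have "T = (\<Union>g\<in>leaves \<rightarrow>\<^sub>E V. fiber g)"
    proof (intro equalityI subsetI)
      fix h assume "h \<in> T"
      then have "restrict h leaves \<in> leaves \<rightarrow>\<^sub>E V"
        by (auto simp: T_def tree_copies_def leaves_def)
      then show "h \<in> (\<Union>g\<in>leaves \<rightarrow>\<^sub>E V. fiber g)" using \<open>h \<in> T\<close> by (auto simp: fiber_def)
    qed (auto simp: fiber_def)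
    then have "card T \<le> (\<Sum>g\<in>leaves \<rightarrow>\<^sub>E V. card (fiber g))"
      using card_UN_le[of "leaves \<rightarrow>\<^sub>E V" fiber] finite_V by (simp add: finite_PiE leaves_def)
    also have "\<dots> \<le> card (leaves \<rightarrow>\<^sub>E V) * m ^ M"
      using sum_bounded_above[of "leaves \<rightarrow>\<^sub>E V" "\<lambda>g. card (fiber g)" "m ^ M"] small by simp
    also have "card (leaves \<rightarrow>\<^sub>E V) = n ^ R"
      by (simp add: card_PiE leaves_def N_def n_def)
    finally show False using cardT by simp
  qed
  then obtain h1 where h1: "h1 \<in> fiber g" by (metis card.empty all_not_in_conv not_less_zero)
  define C where "C = {..<k} \<union> leaves"
  have common: "h i = h1 i" if "h \<in> fiber g" "i \<in> C" for h i
  proof (cases "i < k")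
    case True
    then show ?thesis using that h1 by (simp add: fiber_def T_def tree_copies_def)
  next
    case False
    then have "i \<in> leaves" using that by (simp add: C_def)
    moreover have "restrict h leaves = restrict h1 leaves" using that h1 by (simp add: fiber_def)
    ultimately show ?thesis by (metis restrict_apply')
  qed
  define U0 where "U0 = h1 ` C"
  have finC: "finite C" by (simp add: C_def leaves_def)
  have card_U0: "card U0 \<le> k + R"
  proof -
    have "card U0 \<le> card C" unfolding U0_def by (rule card_image_le[OF finC])
    also have "\<dots> \<le> k + R" unfolding C_def using card_Un_le[of "{..<k}" leaves]
      by (simp add: leaves_def N_def)
    finally show ?thesis .
  qed
  have fiber_V: "h ` {..<N} \<subseteq> V" if "h \<in> fiber g" for h
    using that by (auto simp: fiber_def T_def tree_copies_def)
  have CN: "C \<subseteq> {..<N}" using Ne by (auto simp: C_def leaves_def)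
  \<comment> \<open>A largest good set is considered. If a whole copy still fits within
    \<open>m\<close> points, adding one will enlarge it; hence it must have more than
    \<open>m - M\<close> points.\<close>
  define good where "good U \<longleftrightarrow> U0 \<subseteq> U \<and> U \<subseteq> V \<and> card U \<le> m \<and>
    s * (real (card U) - real (card U0)) \<le> real (card (faces D U))" for U
  have "good U0"
    using fiber_V[OF h1] CN card_U0 Me Ne Nm by (auto simp: good_def U0_def)
  moreover have "\<forall>U. good U \<longrightarrow> card U < Suc m" by (simp add: good_def)
  ultimately obtain U where U: "good U" and U_max: "\<And>U'. good U' \<Longrightarrow> card U' \<le> card U"
    using ex_has_greatest_nat[of good U0 card "Suc m"] by blast
  have finU: "finite U" using U finite_V finite_subset by (auto simp: good_def)
  have "m < card U + M"
  proof (rule ccontr)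
    assume "\<not> m < card U + M"
    then have room: "card U + M \<le> m" by simp
    \<comment> \<open>Copies in the fiber differ only on the \<open>M\<close> inner vertices outside
      block \<open>0\<close>, so at most \<open>card U ^ M \<le> m ^ M\<close> of them stay inside
      \<open>U\<close>.\<close>
    have "\<exists>h\<in>fiber g. \<not> h ` {..<N} \<subseteq> U"
    proof (rule ccontr)
      assume "\<not> ?thesis"
      then have inU: "h ` {..<N} \<subseteq> U" if "h \<in> fiber g" for h using that by blast
      let ?Z = "{k..<k * Suc B}"
      have "inj_on (\<lambda>h. restrict h ?Z) (fiber g)"
      proof (rule inj_onI)
        fix h h' assume hh: "h \<in> fiber g" "h' \<in> fiber g" and eq: "restrict h ?Z = restrict h' ?Z"
        show "h = h'"
        proof
          fix i
          consider "i \<in> C" | "i \<in> ?Z" | "i \<ge> N" unfolding C_def leaves_def by force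
          then show "h i = h' i"
          proof cases
            case 1 then show ?thesis using common hh by metis
          next
            case 2 then show ?thesis using eq by (metis restrict_apply')
          next
            case 3
            then show ?thesis using hh by (auto simp: fiber_def T_def tree_copies_def PiE_def extensional_def)
          qed
        qed
      qed
      moreover have "(\<lambda>h. restrict h ?Z) ` fiber g \<subseteq> ?Z \<rightarrow>\<^sub>E U"
      proof (intro image_subsetI restrict_PiE_iff[THEN iffD2] ballI)
        fix h i assume "h \<in> fiber g" "i \<in> ?Z"
        then show "h i \<in> U" using inU[of h] by (auto simp: N_def)
      qed
      ultimately have "card (fiber g) \<le> card (?Z \<rightarrow>\<^sub>E U)"
        using finU by (intro card_inj_on_le) (auto intro: finite_PiE)
      also have "\<dots> = card U ^ M" by (simp add: card_PiE M_def)
      also have "\<dots> \<le> m ^ M" using room by (intro power_mono) auto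
      finally show False using g by simp
    qed
    then obtain h where h: "h \<in> fiber g" "\<not> h ` {..<N} \<subseteq> U" by blast
    define I where "I = {i \<in> {..<N}. h i \<notin> U}"
    have hT: "h \<in> tree_copies att V H k h0 N" using h by (simp add: fiber_def T_def)
    \<comment> \<open>The first block and the leaves are mapped into
      \<open>U0 \<subseteq> U\<close>, so only inner vertices are new and the balance of the tree
      applies.\<close>
    have I_sub: "I \<subseteq> {k..<k * Suc B}"
    proof
      fix i assume i: "i \<in> I"
      have "i \<notin> C"
      proof
        assume "i \<in> C"
        then have "h i \<in> U0" using common[OF h(1)] by (simp add: U0_def)
        then show False using i U by (auto simp: I_def good_def)
      qed
      then show "i \<in> {k..<k * Suc B}" using i by (auto simp: I_def C_def leaves_def)
    qed
    have I_ne: "I \<noteq> {}" using h by (auto simp: I_def)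
    have I_card: "card I \<le> M"
      using card_mono[OF _ I_sub] by (simp add: M_def)
    have finI: "finite I" by (simp add: I_def)
    have inj: "inj_on h {..<N}" using hT by (simp add: tree_copies_def)
    let ?U = "U \<union> h ` {..<N}"
    have "?U = U \<union> h ` I" by (auto simp: I_def)
    moreover have "card (U \<union> h ` I) = card U + card I"
    proof -
      have "card (U \<union> h ` I) = card U + card (h ` I)"
        using finU finI by (intro card_Un_disjoint) (auto simp: I_def)
      also have "card (h ` I) = card I"
        by (rule card_image) (rule inj_on_subset[OF inj], auto simp: I_def)
      finally show ?thesis .
    qed
    ultimately have card_U': "card ?U = card U + card I" by simp
    have "s * real (card I) \<le> (\<Sum>i\<in>{k..<N}. if i \<in> I then 2 ^ k else 2 ^ k - 2 ^ (k - card (att i \<inter> I)))"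
      using attach_balanced[OF k0 B0 I_sub, of R] unfolding s_eq att_def N_def .
    moreover have "real (card (faces D U)) + (\<Sum>i\<in>{k..<N}. if i \<in> I then 2 ^ k else 2 ^ k - 2 ^ (k - card (att i \<inter> I)))
        \<le> real (card (faces D ?U))"
      by (rule card_faces_copy_ge[OF finite_V D_subset down HD hT att(1,2) I_def])
    ultimately have "s * (real (card ?U) - real (card U0)) \<le> real (card (faces D ?U))"
      using U by (simp add: card_U' good_def algebra_simps)
    then have "good ?U"
      using U fiber_V[OF h(1)] card_U' I_card room by (auto simp: good_def)
    then have "card I = 0" using U_max card_U' by fastforce
    then show False using I_ne finI by simp
  qed
  \<comment> \<open>\<open>card U0 \<le> k + R\<close> and \<open>N = k + M + R\<close>. The
    resulting \<open>s (m - N)\<close> faces are too many, because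
    \<open>N \<le> p t\<close>.\<close>
  then have "real m - real N < real (card U) - real (card U0)"
    using card_U0 Me Ne by linarith
  then have "s * (real m - real N) < s * (real (card U) - real (card U0))"
    using s_pos by simp
  also have "\<dots> \<le> s * (real m - 3 * real p * real t)"
    using U sparse[of U] by (simp add: good_def)
  finally have "3 * real p * real t < real N" using s_pos by simp
  also have "real N \<le> real (p * t)" using N_le of_nat_le_iff by blast
  finally show False using pt by (simp add: mult_less_cancel_right)
qed

end

section \<open>Degeneracy and shadows\<close>

text \<open>Degeneracy argument: choose a \<open>k\<close>-set \<open>Q\<close> of codegree at most
  \<open>d\<close> and remove all members containing it. This costs at most \<open>d\<close> members
  and takes \<open>Q\<close> out of the shadow for good.\<close>

lemma card_le_degree_shadow:
  fixes d :: real
  assumes "finite F" and "\<And>E. E \<in> F \<Longrightarrow> card E = Suc k"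
    and "\<And>H. H \<subseteq> F \<Longrightarrow> H \<noteq> {} \<Longrightarrow>
      \<exists>E\<in>H. \<exists>Q\<subseteq>E. card Q = k \<and> real (card {y. insert y Q \<in> H}) \<le> d"
  shows "real (card F) \<le> d * real (card {Q. card Q = k \<and> (\<exists>E\<in>F. Q \<subseteq> E)})"
  using assms
proof (induction "card F" arbitrary: F rule: less_induct)
  case less
  define sh where "sh F = {Q. card Q = k \<and> (\<exists>E\<in>F. Q \<subseteq> E)}" for F :: "'a set set"
  have fin_mem: "finite E" if "E \<in> F" for E
    using less.prems(2)[OF that] card.infinite by fastforce
  then have fin_Un: "finite (\<Union>F)" using less.prems(1) by blast
  show ?case
  proof (cases "F = {}")
    case True
    then have "sh F = {}" by (simp add: sh_def)
    then show ?thesis using True by (simp add: sh_def[symmetric])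
  next
    case False
    then obtain E Q where EQ: "E \<in> F" "Q \<subseteq> E" "card Q = k" and d: "real (card {y. insert y Q \<in> F}) \<le> d"
      using less.prems(3)[OF order_refl] by blast
    define F' where "F' = {E \<in> F. \<not> Q \<subseteq> E}"
    have "F' \<subset> F" using EQ by (auto simp: F'_def)
    then have less_card: "card F' < card F" using less.prems(1) by (rule psubset_card_mono[rotated])
    have IH: "real (card F') \<le> d * real (card (sh F'))"
      unfolding sh_def
    proof (rule less.hyps[OF less_card])
      show "finite F'" using less.prems(1) by (simp add: F'_def)
      show "card E = Suc k" if "E \<in> F'" for E using that less.prems(2) by (simp add: F'_def)
      show "\<exists>E\<in>H. \<exists>Q\<subseteq>E. card Q = k \<and> real (card {y. insert y Q \<in> H}) \<le> d"
        if "H \<subseteq> F'" "H \<noteq> {}" for H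
      proof (rule less.prems(3)[OF _ that(2)])
        show "H \<subseteq> F" using that(1) \<open>F' \<subset> F\<close> by blast
      qed
    qed
    have fin_sh: "finite (sh F)"
      by (rule finite_subset[of _ "Pow (\<Union>F)"]) (use fin_Un in \<open>auto simp: sh_def\<close>)
    have "sh F' \<subseteq> sh F - {Q}" by (auto simp: sh_def F'_def)
    then have "card (sh F') \<le> card (sh F - {Q})" using fin_sh by (intro card_mono) auto
    moreover have "Q \<in> sh F" using EQ by (auto simp: sh_def)
    ultimately have sh: "card (sh F') + 1 \<le> card (sh F)"
      using fin_sh by (metis Suc_eq_plus1 Suc_leI card_Diff1_less le_less_trans)
    have "F - F' \<subseteq> (\<lambda>y. insert y Q) ` {y. insert y Q \<in> F}"
    proof
      fix E' assume "E' \<in> F - F'"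
      then have E': "E' \<in> F" "Q \<subseteq> E'" by (auto simp: F'_def)
      have "finite Q" using E' fin_mem finite_subset by blast
      have "card (E' - Q) = Suc k - k"
        using E' EQ less.prems(2) \<open>finite Q\<close> by (simp add: card_Diff_subset)
      then obtain y where "E' - Q = {y}" by (auto simp: card_1_singleton_iff Suc_diff_le)
      then have "E' = insert y Q" using E' by blast
      then show "E' \<in> (\<lambda>y. insert y Q) ` {y. insert y Q \<in> F}" using E' by blast
    qed
    moreover have "finite {y. insert y Q \<in> F}"
      by (rule finite_subset[OF _ fin_Un]) auto
    ultimately have "card (F - F') \<le> card {y. insert y Q \<in> F}"
      by (metis card_image_le card_mono finite_imageI le_trans)
    then have "real (card (F - F')) \<le> d" using d by linarith
    moreover have "card F = card F' + card (F - F')"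
      using less.prems(1) \<open>F' \<subset> F\<close> less_card card_Diff_subset[of F' F] finite_subset[of F' F] by auto
    ultimately have "real (card F) \<le> d * (real (card (sh F')) + 1)"
      using IH by (simp add: algebra_simps)
    also have "\<dots> \<le> d * real (card (sh F))"
    proof (rule mult_left_mono)
      show "0 \<le> d" using d by (rule order_trans[rotated]) simp
    qed (use sh in linarith)
    finally show ?thesis by (simp add: sh_def)
  qed
qed

section \<open>Counting faces by size\<close>

context sparse_complex
begin

definition level :: "nat \<Rightarrow> 'a set set" where
  "level k = {F \<in> D. card F = k}"

lemma finite_level: "finite (level k)"
  using finite_D by (simp add: level_def)

lemma finite_face: "F \<in> D \<Longrightarrow> finite F"
  using finite_V D_subset finite_subset by blast

text \<open>A subfamily without a \<open>k\<close>-set of small codegree is excluded by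
  \<open>no_dense_subfamily\<close>, and the shadow of faces consists of faces.\<close>

lemma card_level_Suc:
  assumes k: "1 \<le> k" "k \<le> t"
  shows "real (card (level (Suc k)))
    \<le> 2 * real m * real (card V) powr codegree_exponent k * real (card (level k))"
proof -
  let ?d = "2 * real m * real (card V) powr codegree_exponent k"
  have "real (card (level (Suc k))) \<le> ?d * real (card {Q. card Q = k \<and> (\<exists>E\<in>level (Suc k). Q \<subseteq> E)})"
  proof (rule card_le_degree_shadow[OF finite_level])
    show "card E = Suc k" if "E \<in> level (Suc k)" for E using that by (simp add: level_def)
    show "\<exists>E\<in>H. \<exists>Q\<subseteq>E. card Q = k \<and> real (card {y. insert y Q \<in> H}) \<le> ?d"
      if "H \<subseteq> level (Suc k)" "H \<noteq> {}" for H
    proof (rule ccontr)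
      assume "\<not> ?thesis"
      then have "\<forall>E\<in>H. \<forall>Q\<subseteq>E. card Q = k \<longrightarrow> ?d < real (card {y. insert y Q \<in> H})"
        by (auto simp: not_le)
      then have "?d \<le> real (card {y. insert y Q \<in> H})" if "E \<in> H" "Q \<subseteq> E" "card Q = k" for E Q
        using that less_imp_le by blast
      moreover have "H \<subseteq> D" "\<And>E. E \<in> H \<Longrightarrow> card E = Suc k" using that by (auto simp: level_def)
      ultimately show False using no_dense_subfamily[OF k] that(2) by blast
    qed
  qed
  also have "\<dots> \<le> ?d * real (card (level k))"
  proof (intro mult_left_mono of_nat_mono card_mono finite_level)
    show "{Q. card Q = k \<and> (\<exists>E\<in>level (Suc k). Q \<subseteq> E)} \<subseteq> level k"
      using down by (auto simp: level_def)
  qed simp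
  finally show ?thesis .
qed

lemma card_level_1: "card (level 1) \<le> card V"
proof -
  have "level 1 \<subseteq> (\<lambda>x. {x}) ` V"
    using D_subset by (auto simp: level_def card_1_singleton_iff)
  then show ?thesis using finite_V by (meson card_image_le card_mono finite_imageI le_trans)
qed

text \<open>For \<open>k \<ge> 1\<close> the closed form of \<open>1\<close> plus the sum of
  \<open>codegree_exponent j\<close> over \<open>1 \<le> j < k\<close>. At \<open>Suc t\<close> it
  is the exponent of the theorem.\<close>

definition growth_exponent :: "nat \<Rightarrow> real" where
  "growth_exponent k = real k - (2 ^ k - real k - 1) / (s - 1)"

lemma s_ge_2: "s \<ge> 2"
proof -
  have "real (2 * q) \<le> real p" using p_ge_2q of_nat_le_iff by blast
  then show ?thesis using q_pos by (simp add: s_def field_simps)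
qed

lemma growth_exponent_Suc: "growth_exponent (Suc k) = growth_exponent k + codegree_exponent k"
proof -
  have "real p = s * real q" using q_pos by (simp add: s_def)
  then have "codegree_exponent k = ((s - 2 ^ k) * real q) / ((s - 1) * real q)"
    by (simp add: codegree_exponent_def algebra_simps)
  also have "\<dots> = (s - 2 ^ k) / (s - 1)" using q_pos by simp
  finally show ?thesis using s_ge_2 by (simp add: growth_exponent_def field_simps)
qed

text \<open>The increments are nonnegative while \<open>2^k \<le> s\<close>, which holds for
  \<open>k \<le> t\<close>.\<close>

lemma growth_exponent_mono:
  assumes "k \<le> Suc t"
  shows "growth_exponent k \<le> growth_exponent (Suc t)"
  using assms
proof (induction rule: inc_induct)
  case (step k)
  have "(2 :: nat) ^ k \<le> 2 ^ t" using step by (intro power_increasing) auto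
  then have "2 ^ k * q \<le> p" using p_ge by (meson le_trans mult_le_mono1)
  then have "real (2 ^ k * q) \<le> real p" using of_nat_le_iff by blast
  then have "codegree_exponent k \<ge> 0" using p_ge_2q q_pos by (simp add: codegree_exponent_def)
  then show ?case using step growth_exponent_Suc[of k] by linarith
qed simp

lemma card_V_ge_1: "1 \<le> real (card V)"
  using m_pos m_le by linarith

lemma card_level_le:
  assumes "1 \<le> k" "k \<le> Suc t"
  shows "real (card (level k)) \<le> (2 * real m) ^ (k - 1) * real (card V) powr growth_exponent k"
  using assms
proof (induction k rule: dec_induct)
  case base
  then show ?case using card_level_1 card_V_ge_1 by (simp add: growth_exponent_def)
next
  case (step k)
  have "real (card (level (Suc k)))
      \<le> 2 * real m * real (card V) powr codegree_exponent k * real (card (level k))"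
    using step by (intro card_level_Suc) auto
  also have "\<dots> \<le> 2 * real m * real (card V) powr codegree_exponent k
      * ((2 * real m) ^ (k - 1) * real (card V) powr growth_exponent k)"
    using step by (intro mult_left_mono) auto
  also have "\<dots> = (2 * real m) ^ k * real (card V) powr growth_exponent (Suc k)"
    using step(1) by (simp add: growth_exponent_Suc powr_add power_eq_if)
  finally show ?case by simp
qed

lemma card_level_le_top:
  assumes "k \<le> Suc t"
  shows "real (card (level k)) \<le> (2 * real m) ^ t * real (card V) powr growth_exponent (Suc t)"
proof -
  have m1: "1 \<le> 2 * real m" using m_pos by linarith
  show ?thesis
  proof (cases "k = 0")
    \<comment> \<open>The recursion over face sizes starts at \<open>k = 1\<close>, so the empty
      face is treated apart.\<close>
    case True
    have "level 0 \<subseteq> {{}}" using finite_face by (auto simp: level_def)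
    then have "card (level 0) \<le> card {{} :: 'a set}" by (intro card_mono) auto
    then have "real (card (level k)) \<le> 1" using True by simp
    also have "1 \<le> (2 * real m) ^ t * real (card V) powr growth_exponent (Suc t)"
    proof -
      have "growth_exponent (Suc t) \<ge> 0"
        using growth_exponent_mono[of 1] by (simp add: growth_exponent_def)
      then have "1 \<le> real (card V) powr growth_exponent (Suc t)"
        using card_V_ge_1 by (simp add: ge_one_powr_ge_zero)
      then show ?thesis using mult_mono[OF one_le_power[OF m1, of t], of 1] by simp
    qed
    finally show ?thesis .
  next
    case False
    then have "real (card (level k)) \<le> (2 * real m) ^ (k - 1) * real (card V) powr growth_exponent k"
      using assms by (intro card_level_le) auto
    also have "\<dots> \<le> (2 * real m) ^ t * real (card V) powr growth_exponent (Suc t)"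
      using assms m1 card_V_ge_1 growth_exponent_mono[OF assms]
      by (intro mult_mono power_increasing powr_mono) auto
    finally show ?thesis .
  qed
qed

section \<open>Links and stars of faces of size \<open>t + 1\<close>\<close>

text \<open>Each \<open>A\<close> in \<open>G\<close> yields \<open>2^(t + 1)\<close> faces
  \<open>A \<union> C\<close> with \<open>C \<subseteq> Q\<close>, all distinct and inside
  \<open>Q \<union> W\<close>. Since \<open>s \<le> 2^(t + 1)\<close>, dividing the sparsity bound
  by this power bounds \<open>card G\<close>.\<close>

lemma card_link_le:
  assumes Q: "Q \<in> level (Suc t)" and W: "W \<subseteq> V" "card (Q \<union> W) \<le> m"
    and G: "\<And>A. A \<in> G \<Longrightarrow> A \<subseteq> W \<and> A \<inter> Q = {} \<and> A \<union> Q \<in> D"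
  shows "card G + 3 * (p * t) \<le> m"
proof -
  have finQ: "finite Q" and QV: "Q \<subseteq> V" and cardQ: "card Q = Suc t"
    using Q finite_face D_subset by (auto simp: level_def)
  have "inj_on (\<lambda>(A, C). A \<union> C) (G \<times> Pow Q)"
  proof (rule inj_onI, clarify)
    fix A C A' C'
    assume "A \<in> G" "A' \<in> G" "C \<subseteq> Q" "C' \<subseteq> Q" "A \<union> C = A' \<union> C'"
    moreover from this have "A \<inter> Q = {}" "A' \<inter> Q = {}" using G by auto
    ultimately show "A = A' \<and> C = C'" by blast
  qed
  moreover have "(\<lambda>(A, C). A \<union> C) ` (G \<times> Pow Q) \<subseteq> faces D (Q \<union> W)"
  proof clarify
    fix A C assume "A \<in> G" "C \<subseteq> Q"
    then show "A \<union> C \<in> faces D (Q \<union> W)"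
      using G[of A] down[of "A \<union> Q" "A \<union> C"] by (auto simp: faces_def)
  qed
  moreover have "finite (faces D (Q \<union> W))" using finite_D by (simp add: faces_def)
  ultimately have "card (G \<times> Pow Q) \<le> card (faces D (Q \<union> W))"
    by (rule card_inj_on_le)
  then have "real (card G) * 2 ^ Suc t \<le> real (card (faces D (Q \<union> W)))"
    using finQ cardQ by (simp add: card_cartesian_product card_Pow flip: of_nat_le_iff[where 'a = real])
  also have "\<dots> \<le> s * (real m - 3 * real p * real t)"
    using sparse[of "Q \<union> W"] QV W by simp
  also have "\<dots> \<le> 2 ^ Suc t * (real m - 3 * real p * real t)"
  proof (rule mult_right_mono)
    have "real p < real (2 ^ Suc t * q)" using p_less of_nat_less_iff by blast
    then show "s \<le> 2 ^ Suc t" using q_pos by (simp add: s_def field_simps)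
    have "real (3 * (p * t)) \<le> real m" using m_ge of_nat_le_iff by blast
    then show "0 \<le> real m - 3 * real p * real t" by simp
  qed
  finally have "2 ^ Suc t * real (card G) \<le> 2 ^ Suc t * (real m - 3 * real p * real t)"
    by (simp only: mult.commute)
  then have "real (card G) \<le> real m - 3 * real p * real t"
    by (rule mult_left_le_imp_le) simp
  then have "real (card G + 3 * (p * t)) \<le> real m" by simp
  then show ?thesis using of_nat_le_iff by blast
qed

text \<open>The link bound is used twice. Applied to singletons it shows that the link has fewer
  than \<open>m - Suc t\<close> vertices, so the whole star fits into \<open>m\<close> points; then
  it is applied to all faces of the link.\<close>

lemma card_star_le:
  assumes Q: "Q \<in> level (Suc t)"
  shows "card {F \<in> D. Q \<subseteq> F} \<le> m"
proof -
  have finQ: "finite Q" and QV: "Q \<subseteq> V" and cardQ: "card Q = Suc t"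
    using Q finite_face D_subset by (auto simp: level_def)
  have p2: "2 \<le> p" using p_ge_2q q_pos by linarith
  have "2 * t \<le> p * t" using p2 by (rule mult_le_mono1)
  then have big: "Suc t < 3 * (p * t)" using t_pos by linarith
  define Y where "Y = {y \<in> V - Q. insert y Q \<in> D}"
  have finY: "finite Y" using finite_V by (simp add: Y_def)
  have "card Y < m - Suc t"
  proof (rule ccontr)
    assume "\<not> card Y < m - Suc t"
    then obtain Y' where Y': "Y' \<subseteq> Y" "card Y' = m - Suc t"
      using obtain_subset_with_card_n[of "m - Suc t" Y] by auto
    have "card (Q \<union> Y') \<le> Suc t + (m - Suc t)"
      using card_Un_le[of Q Y'] Y' cardQ by simp
    then have "card (Q \<union> Y') \<le> m" using big m_ge by simp
    then have "card ((\<lambda>y. {y}) ` Y') + 3 * (p * t) \<le> m"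
      using Y' by (intro card_link_le[OF Q, of Y']) (auto simp: Y_def)
    moreover have "card ((\<lambda>y. {y}) ` Y') = card Y'" by (rule card_image) simp
    ultimately show False using Y' big by linarith
  qed
  then have room: "card (Q \<union> Y) \<le> m" using card_Un_le[of Q Y] cardQ by simp
  let ?G = "(\<lambda>F. F - Q) ` {F \<in> D. Q \<subseteq> F}"
  have "card ?G + 3 * (p * t) \<le> m"
  proof (rule card_link_le[OF Q _ room])
    show "Y \<subseteq> V" by (auto simp: Y_def)
    show "A \<subseteq> Y \<and> A \<inter> Q = {} \<and> A \<union> Q \<in> D" if A: "A \<in> ?G" for A
    proof -
      obtain F where F: "F \<in> D" "Q \<subseteq> F" "A = F - Q" using A by blast
      have "y \<in> Y" if "y \<in> A" for y
        using that F D_subset down[OF F(1), of "insert y Q"] by (auto simp: Y_def)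
      moreover have "A \<union> Q = F" using F by blast
      ultimately show ?thesis using F by auto
    qed
  qed
  moreover have "card ?G = card {F \<in> D. Q \<subseteq> F}"
    by (rule card_image) (auto simp: inj_on_def)
  ultimately show ?thesis by simp
qed

text \<open>A face has size at most \<open>t\<close> or lies in the star of a face of size
  \<open>t + 1\<close>. The \<open>t + 1\<close> small levels and the stars of size at most
  \<open>m\<close> give the factor \<open>t + 1 + m \<le> 2 m\<close>.\<close>

lemma card_complex_le:
  "real (card D) \<le> (2 * real m) ^ Suc t * real (card V) powr growth_exponent (Suc t)"
proof -
  let ?b = "(2 * real m) ^ t * real (card V) powr growth_exponent (Suc t)"
  have "D \<subseteq> (\<Union>k\<in>{..t}. level k) \<union> (\<Union>Q\<in>level (Suc t). {F \<in> D. Q \<subseteq> F})"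
  proof
    fix F assume F: "F \<in> D"
    show "F \<in> (\<Union>k\<in>{..t}. level k) \<union> (\<Union>Q\<in>level (Suc t). {F \<in> D. Q \<subseteq> F})"
    proof (cases "card F \<le> t")
      case True then show ?thesis using F by (auto simp: level_def)
    next
      case False
      then obtain Q where "Q \<subseteq> F" "card Q = Suc t"
        using obtain_subset_with_card_n[of "Suc t" F] by auto
      then show ?thesis using F down by (auto simp: level_def)
    qed
  qed
  moreover have "finite ((\<Union>k\<in>{..t}. level k) \<union> (\<Union>Q\<in>level (Suc t). {F \<in> D. Q \<subseteq> F}))"
    using finite_D finite_level by auto
  ultimately have "card D \<le> card ((\<Union>k\<in>{..t}. level k) \<union> (\<Union>Q\<in>level (Suc t). {F \<in> D. Q \<subseteq> F}))"
    by (rule card_mono[rotated])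
  also have "\<dots> \<le> card (\<Union>k\<in>{..t}. level k) + card (\<Union>Q\<in>level (Suc t). {F \<in> D. Q \<subseteq> F})"
    by (rule card_Un_le)
  also have "\<dots> \<le> (\<Sum>k\<in>{..t}. card (level k)) + (\<Sum>Q\<in>level (Suc t). card {F \<in> D. Q \<subseteq> F})"
    using finite_level by (intro add_mono card_UN_le) auto
  also have "(\<Sum>Q\<in>level (Suc t). card {F \<in> D. Q \<subseteq> F}) \<le> card (level (Suc t)) * m"
    using sum_bounded_above[of "level (Suc t)" "\<lambda>Q. card {F \<in> D. Q \<subseteq> F}" m] card_star_le by simp
  finally have "card D \<le> (\<Sum>k\<in>{..t}. card (level k)) + card (level (Suc t)) * m" by simp
  then have "real (card D) \<le> real ((\<Sum>k\<in>{..t}. card (level k)) + card (level (Suc t)) * m)"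
    by (rule of_nat_mono)
  also have "\<dots> = (\<Sum>k\<in>{..t}. real (card (level k))) + real (card (level (Suc t))) * real m"
    by (simp only: of_nat_add of_nat_sum of_nat_mult)
  also have "\<dots> \<le> (\<Sum>k\<in>{..t}. ?b) + ?b * real m"
    by (intro add_mono sum_mono mult_right_mono card_level_le_top) auto
  also have "\<dots> = (real t + 1 + real m) * ?b" by (simp add: algebra_simps)
  also have "\<dots> \<le> (2 * real m) * ?b"
  proof (rule mult_right_mono)
    have "1 * t \<le> p * t" using p_pos by (intro mult_le_mono1) simp
    then show "real t + 1 + real m \<le> 2 * real m" using m_ge t_pos by linarith
  qed simp
  finally show ?thesis by (simp add: mult.assoc)
qed

end

section \<open>From shatter functions to sparse complexes\<close>

lemma shatter_attained:
  assumes "shatter_defined X n"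
  obtains Y where "Y \<subseteq> X" "finite Y" "card Y = n" "card (trace S Y) = shatter X S n"
proof -
  have "shatter X S n \<in> {card (trace S Y) | Y. Y \<subseteq> X \<and> finite Y \<and> card Y = n}"
    unfolding shatter_def by (rule Max_in[OF shatter_set_finite shatter_set_nonempty[OF assms]])
  then obtain Y where "shatter X S n = card (trace S Y)" "Y \<subseteq> X" "finite Y" "card Y = n" by blast
  then show thesis by (intro that[of Y]) simp_all
qed

lemma card_trace_le_shatter:
  assumes "Y \<subseteq> X" "finite Y" "card Y = n"
  shows "card (trace S Y) \<le> shatter X S n"
  unfolding shatter_def using assms by (intro Max_ge shatter_set_finite) auto

lemma trace_trace:
  assumes "Y \<subseteq> V"
  shows "trace (trace S V) Y = trace S Y"
proof -
  have "e \<inter> V \<inter> Y = e \<inter> Y" for e using assms by blast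
  then show ?thesis by (simp add: trace_def setcompr_eq_image image_image)
qed

theorem theorem2:
  fixes s :: rat and q :: int and t m :: nat
    and X :: "'a set" and S :: "'a set set"
  assumes "s \<ge> 2"
    and "q = snd (quotient_of s)"
    and "int t = \<lfloor>log 2 (real_of_rat s)\<rfloor>"
    and "m \<ge> 1"
    and "set_system X S"
    and "shatter_defined X m"
    and "real (shatter X S m)
           \<le> real_of_rat s * real m
             - 3 * real_of_int q * (real_of_rat s)^2 * log 2 (real_of_rat s)"
  shows "\<forall>n\<ge>m. shatter_defined X n \<longrightarrow>
           real (shatter X S n)
             \<le> 2 ^ (t + 2) * real m ^ (2 * t + 2)
               * real n powr (real t + 1 - (2 ^ (t + 1) - real t - 2) / (real_of_rat s - 1))"
proof (intro allI impI)
  fix n assume nm: "m \<le> n" and "shatter_defined X n"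
  then obtain V where V: "V \<subseteq> X" "finite V" "card V = n" "card (trace S V) = shatter X S n"
    using shatter_attained by blast
  have "trace S V \<subseteq> Pow V" by (auto simp: trace_def)
  \<comment> \<open>Passing to a hereditary family on the \<open>n\<close> points of
    \<open>V\<close> keeps the number of sets and does not increase any trace, so the hypothesis on
    \<open>m\<close> points survives.\<close>
  then obtain D where D: "D \<subseteq> Pow V" "card D = shatter X S n"
    and down: "\<And>A B. A \<in> D \<Longrightarrow> B \<subseteq> A \<Longrightarrow> B \<in> D"
    and tr: "\<And>Y. card (trace D Y) \<le> card (trace (trace S V) Y)"
    using exists_hereditary[OF V(2)] V(4) by metis
  define r where "r = real_of_rat s"
  define a where "a = fst (quotient_of s)"
  define b where "b = nat q"
  define p where "p = nat a"
  have r2: "r \<ge> 2" using \<open>s \<ge> 2\<close> of_rat_less_eq[of 2 s, where 'a = real] by (simp add: r_def)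
  have q0: "q > 0" using assms(2) quotient_of_denom_pos' by simp
  have "s = of_int a / of_int q"
    using quotient_of_div[of s a q] assms(2) by (simp add: a_def)
  then have "r = real_of_int a / real_of_int q" by (simp add: r_def of_rat_divide)
  moreover from this have "a > 0"
    using r2 q0 divide_nonpos_pos[of "real_of_int a" "real_of_int q"] by (cases "a > 0") auto
  ultimately have r: "r = real p / real b" using q0 by (simp add: p_def b_def)
  have b0: "b > 0" using q0 by (simp add: b_def)
  have t_le: "real t \<le> log 2 r" and t_less: "log 2 r < real t + 1"
    using assms(3) unfolding r_def[symmetric] by linarith+
  have "2 powr real t \<le> r" using t_le r2 by (simp add: le_log_iff)
  then have pow_le: "2 ^ t \<le> r" by (simp add: powr_realpow)
  have "r < 2 powr (real t + 1)" using t_less r2 by (simp add: log_less_iff)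
  also have "2 powr (real t + 1) = 2 ^ Suc t" by (simp add: powr_add powr_realpow)
  finally have less_pow: "r < 2 ^ Suc t" .
  have pb: "real p = r * real b" using r b0 by simp
  have sparse: "real (card (faces D U)) \<le> r * (real m - 3 * real p * real t)"
    if U: "U \<subseteq> V" "card U \<le> m" for U
  proof -
    \<comment> \<open>The shatter function concerns exactly \<open>m\<close> points, so
      \<open>U\<close> is enlarged to such a set; a face inside \<open>Y\<close> is its own
      trace.\<close>
    obtain Y where Y: "U \<subseteq> Y" "Y \<subseteq> V" "card Y = m"
      using exists_subset_between[of U m V] U V nm by auto
    have finY: "finite Y" using Y V finite_subset by blast
    have "F \<in> trace D Y" if "F \<in> faces D U" for F
    proof -
      have "F = F \<inter> Y" "F \<in> D" using that Y by (auto simp: faces_def)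
      then show ?thesis unfolding trace_def by blast
    qed
    then have "faces D U \<subseteq> trace D Y" by blast
    moreover have "finite (trace D Y)"
      by (rule finite_subset[of _ "Pow Y"]) (use finY in \<open>auto simp: trace_def\<close>)
    ultimately have "card (faces D U) \<le> card (trace D Y)" by (simp add: card_mono)
    also have "\<dots> \<le> card (trace S Y)" using tr[of Y] Y by (simp add: trace_trace)
    also have "\<dots> \<le> shatter X S m" using Y V finY by (intro card_trace_le_shatter) auto
    finally have "real (card (faces D U)) \<le> real (shatter X S m)" by simp
    also have "\<dots> \<le> r * real m - 3 * real b * r ^ 2 * log 2 r"
      using assms(7) q0 by (simp add: r_def b_def)
    \<comment> \<open>Replacing the logarithm by its floor only weakens the bound; then
      \<open>b r = p\<close> brings out the factor \<open>r\<close>.\<close>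
    also have "\<dots> \<le> r * real m - 3 * real b * r ^ 2 * real t"
      using t_le by (intro diff_left_mono mult_left_mono) auto
    also have "\<dots> = r * (real m - 3 * real p * real t)"
      by (simp add: pb algebra_simps power2_eq_square)
    finally show ?thesis .
  qed
  interpret sparse_complex V D m p b t r
  proof
    have "real (2 ^ t * b) \<le> real p" using mult_right_mono[OF pow_le, of "real b"] by (simp add: pb)
    then show "2 ^ t * b \<le> p" using of_nat_le_iff by blast
    have "real p < real (2 ^ Suc t * b)" using mult_strict_right_mono[OF less_pow, of "real b"] b0 by (simp add: pb)
    then show "p < 2 ^ Suc t * b" using of_nat_less_iff by blast
    have "1 \<le> log 2 r" using r2 by (simp add: le_log_iff)
    then show "1 \<le> t" using t_less by simp
  qed (use V D down nm b0 r sparse in auto)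
  have "real (shatter X S n) \<le> (2 * real m) ^ Suc t * real n powr growth_exponent (Suc t)"
    using card_complex_le by (simp add: D V)
  \<comment> \<open>The count gives the constant \<open>(2 m)^(t + 1)\<close>, which is at most the
    stated one because \<open>m \<ge> 1\<close>.\<close>
  also have "\<dots> \<le> (2 ^ (t + 2) * real m ^ (2 * t + 2)) * real n powr growth_exponent (Suc t)"
  proof (rule mult_right_mono)
    have "(2 * real m) ^ Suc t = 2 ^ Suc t * real m ^ Suc t" by (rule power_mult_distrib)
    also have "\<dots> \<le> 2 ^ (t + 2) * real m ^ (2 * t + 2)"
      using \<open>m \<ge> 1\<close> by (intro mult_mono power_increasing) auto
    finally show "(2 * real m) ^ Suc t \<le> 2 ^ (t + 2) * real m ^ (2 * t + 2)" .
  qed simp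
  also have "growth_exponent (Suc t) = real t + 1 - (2 ^ (t + 1) - real t - 2) / (real_of_rat s - 1)"
    by (simp add: growth_exponent_def algebra_simps flip: r_def)
  finally show "real (shatter X S n)
     \<le> 2 ^ (t + 2) * real m ^ (2 * t + 2)
       * real n powr (real t + 1 - (2 ^ (t + 1) - real t - 2) / (real_of_rat s - 1))" .
qed

end
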